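(* Let $n$ and $m$ be positive integers. There is a bijection between the set of Bott manifolds of Bott--Samelson type determined by sequences in $[n]^m$ and the set of equivalence classes of $\mathrm{AOP}(n,m)$ under the relation $\sim$: \[ \{\mathcal{B}_{\mathbf i} : \mathbf i \in [n]^m\} \stackrel{1:1}{\longleftrightarrow} \mathrm{AOP}(n,m)/\sim . \]
   Context: Notation: $[n]=\{1,\dots,n\}$. Bott manifolds. A Bott matrix of size $m$ is an $m\times m$ lower triangular integer matrix $B=[b_{j,k}]$ with all diagonal entries equal to $-1$. A Bott tower is an iterated $\mathbb{C}P^1$-bundle $\mathcal{B}_m\xrightarrow{\pi_m}\mathcal{B}_{m-1}\to\cdots\to\mathcal{B}_1\xrightarrow{\pi_1}\mathcal{B}_0=\{\text{a point}\}$ with $\mathcal{B}_j=P(\underline{\mathbb C}\oplus\xi_j)$ for a holomorphic line bundle $\xi_j$ over $\mathcal{B}_{j-1}$; its total space $\mathcal{B}_m$ is called a Bott manifold. The Bott matrix $B=[b_{j,k}]$ determines the Bott tower with $\xi_j=\bigotimes_{1\le k<j}\gamma_{j-1,k}^{\otimes b_{j,k}}$, where $\gamma_{j-1,k}$ is the pullback to $\mathcal{B}_{j-1}$ of the tautological line bundle over $\mathcal{B}_k$. The total space is the smooth projective toric variety whose fan in $\mathbb{R}^m$ (lattice $\mathbb{Z}^m$) has primitive ray generators $\mathbf e_1,\dots,\mathbf e_m$ (standard basis) and $\mathbf v_1,\dots,\mathbf v_m$ (the columns of $B$), and whose maximal cones are spanned by the $m$-element sets $S$ of ray generators with $\{\mathbf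 e_i,\mathbf v_i\}\not\subseteq S$ for all $i\in[m]$. This gives a bijection between $m$-dimensional Bott manifolds and Bott matrices of size $m$; accordingly, two Bott manifolds are regarded as equal, as elements of a set of Bott manifolds, exactly when their Bott matrices are equal. Bott--Samelson (BS) type. For $\mathbf i=(i_1,\dots,i_m)\in[n]^m$, the Bott matrix $B_{\mathbf i}=[b_{j,k}]$ is defined by: for $1\le k<j\le m$, $b_{j,k}=-2$ if $i_j=i_k$, $b_{j,k}=1$ if $|i_j-i_k|=1$, and $b_{j,k}=0$ otherwise; $b_{k,j}=0$; and $b_{j,j}=-1$ for $j\in[m]$. The Bott manifold determined by $B_{\mathbf i}$ is denoted $\mathcal{B}_{\mathbf i}$; such Bott manifolds are said to be of Bott--Samelson type. Assemblies. An ordered partition is a sequence $\tau=(\tau^1,\dots,\tau^r)$ of mutually disjoint nonempty sets; $U(\tau)=\tau^1\cup\cdots\cup\tau^r$ and $\min(\tau)=\min(U(\tau))$. An assembly of ordered partitions of $[m]$ is a sequence $\sigma=(\sigma_1,\dots,\sigma_\ell)$ of ordered partitions such that $\{U(\sigma_1),\dots,U(\sigma_\ell)\}$ is a partition of $[m]$ and $\min(\sigma_1)<\cdots<\min(\sigma_\ell)$. Writing $\sigma_a=(\sigma_a^1,\dots,\sigma_a^{r_a})$, the assembly has bound $n$ if $r_1+\cdots+r_\ell+(\ell-1)\le n$. $\mathrm{AOP}(n,m)$ is the set of assemblies of ordered partitions of $[m]$ with bound $n$. For an ordered partition $\eta=(\eta^1,\dots,\eta^r)$ put $\overline{\eta}=(\eta^r,\dots,\eta^1)$.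 For $\sigma=(\sigma_1,\dots,\sigma_\ell)$ and $\tau=(\tau_1,\dots,\tau_{\ell'})$ in $\mathrm{AOP}(n,m)$, $\sigma\sim\tau$ means that $\ell=\ell'$ and, for each $a\in[\ell]$, $\tau_a=\sigma_a$ or $\tau_a=\overline{\sigma_a}$. *)

theory Defs
  imports
    "Jordan_Normal_Form.Matrix"
    "HOL-Analysis.Abstract_Topology"
    "HOL-Library.Disjoint_Sets"
begin

section \<open>Toric varieties\<close>

text \<open>
  Cones live in \<open>carrier_vec m :: real vec set\<close>, the lattice and its dual lattice of characters
  are both \<open>carrier_vec m :: int vec set\<close>, paired by the standard scalar product. Vectors and
  matrices are indexed from 0, sequences and sets in the combinatorial part from 1.
\<close>

definition cone_spanned :: "nat \<Rightarrow> int vec set \<Rightarrow> real vec set" where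
  "cone_spanned m T =
     {vec m (\<lambda>j. \<Sum>v\<in>T. c v * real_of_int (v $ j)) | c. \<forall>v\<in>T. c v \<ge> 0}"

definition dual_monoid :: "nat \<Rightarrow> real vec set \<Rightarrow> int vec set" where
  "dual_monoid m \<sigma> = {u \<in> carrier_vec m. \<forall>x\<in>\<sigma>. map_vec real_of_int u \<bullet> x \<ge> 0}"

definition perp_lattice :: "nat \<Rightarrow> real vec set \<Rightarrow> int vec set" where
  "perp_lattice m \<sigma> = {u \<in> carrier_vec m. \<forall>x\<in>\<sigma>. map_vec real_of_int u \<bullet> x = 0}"

text \<open>
  The complex points of the toric variety of a fan. For a point \<open>x\<close> in the affine chart
  of a cone \<open>\<sigma>\<close> (a monoid homomorphism from \<open>dual_monoid m \<sigma>\<close> to the multiplicative monoid of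
  complex numbers), there is a unique smallest cone whose chart contains \<open>x\<close>; it is the cone whose
  torus orbit contains \<open>x\<close>, and it is the one for which \<open>x\<close> vanishes exactly off \<open>perp_lattice m \<sigma>\<close>.
  Recording \<open>x\<close> in this smallest chart represents every point of the glued variety exactly once:
  \<open>x u = Some z\<close> says that the character \<open>u\<close> is regular at the point, with value \<open>z\<close>.
\<close>

definition toric_points :: "nat \<Rightarrow> real vec set set \<Rightarrow> (int vec \<Rightarrow> complex option) set" where
  "toric_points m \<Sigma> = {x. \<exists>\<sigma>\<in>\<Sigma>.
      dom x = dual_monoid m \<sigma> \<and>
      x (0\<^sub>v m) = Some 1 \<and>
      (\<forall>u\<in>dom x. \<forall>w\<in>dom x. x (u + w) = Some (the (x u) * the (x w))) \<and>
      (\<forall>u\<in>dom x. x u \<noteq> Some 0 \<longleftrightarrow> u \<in> perp_lattice m \<sigma>)}"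

text \<open>
  The analytic topology is the coarsest one in which the domain of regularity of every character is
  open and every character is continuous on its domain of regularity.
\<close>

definition toric_variety :: "nat \<Rightarrow> real vec set set \<Rightarrow> (int vec \<Rightarrow> complex option) topology" where
  "toric_variety m \<Sigma> = topology_generated_by
     {{x \<in> toric_points m \<Sigma>. \<exists>z\<in>V. x u = Some z} | u V. u \<in> carrier_vec m \<and> open V}"


section \<open>Bott manifolds\<close>

definition bott_matrix :: "nat \<Rightarrow> int mat \<Rightarrow> bool" where
  "bott_matrix m B \<longleftrightarrow> B \<in> carrier_mat m m \<and>
     (\<forall>j<m. \<forall>k<m. j < k \<longrightarrow> B $$ (j, k) = 0) \<and> (\<forall>j<m. B $$ (j, j) = -1)"

definition bott_rays :: "int mat \<Rightarrow> int vec set" where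
  "bott_rays B = unit_vec (dim_row B) ` {..<dim_row B} \<union> col B ` {..<dim_row B}"

definition bott_maximal :: "int mat \<Rightarrow> int vec set \<Rightarrow> bool" where
  "bott_maximal B S \<longleftrightarrow> S \<subseteq> bott_rays B \<and> card S = dim_row B \<and>
     (\<forall>i<dim_row B. \<not> {unit_vec (dim_row B) i, col B i} \<subseteq> S)"

text \<open>The maximal cones are simplicial, so their faces are spanned by the subsets of the generators.\<close>

definition bott_fan :: "int mat \<Rightarrow> real vec set set" where
  "bott_fan B = {cone_spanned (dim_row B) T | T S. T \<subseteq> S \<and> bott_maximal B S}"

definition bott_manifold :: "int mat \<Rightarrow> (int vec \<Rightarrow> complex option) topology" where
  "bott_manifold B = toric_variety (dim_row B) (bott_fan B)"

definition words :: "nat \<Rightarrow> nat \<Rightarrow> nat list set" where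
  "words n m = {is. length is = m \<and> set is \<subseteq> {1..n}}"

definition bs_matrix :: "nat list \<Rightarrow> int mat" where
  "bs_matrix is = mat (length is) (length is) (\<lambda>(j, k).
     if j = k then -1
     else if j < k then 0
     else if is ! j = is ! k then -2
     else if \<bar>int (is ! j) - int (is ! k)\<bar> = 1 then 1
     else 0)"

lemma bott_matrix_bs_matrix: "bott_matrix (length is) (bs_matrix is)"
  by (auto simp: bott_matrix_def bs_matrix_def)

definition bs_manifold :: "nat list \<Rightarrow> (int vec \<Rightarrow> complex option) topology" where
  "bs_manifold is = bott_manifold (bs_matrix is)"


subsection \<open>Bott manifolds are equal exactly when their Bott matrices are\<close>

definition nonneg_on :: "nat \<Rightarrow> int vec set \<Rightarrow> int vec set" where
  "nonneg_on m T = {u \<in> carrier_vec m. \<forall>v\<in>T. u \<bullet> v \<ge> 0}"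

lemma scalar_prod_cone:
  assumes "u \<in> carrier_vec m" "T \<subseteq> carrier_vec m"
  shows "map_vec real_of_int u \<bullet> vec m (\<lambda>j. \<Sum>v\<in>T. c v * real_of_int (v $ j))
       = (\<Sum>v\<in>T. c v * real_of_int (u \<bullet> v))"
proof -
  have "map_vec real_of_int u \<bullet> vec m (\<lambda>j. \<Sum>v\<in>T. c v * real_of_int (v $ j))
      = (\<Sum>j\<in>{0..<m}. \<Sum>v\<in>T. c v * (real_of_int (u $ j) * real_of_int (v $ j)))"
    using assms by (auto simp: scalar_prod_def sum_distrib_left algebra_simps intro!: sum.cong)
  also have "\<dots> = (\<Sum>v\<in>T. \<Sum>j\<in>{0..<m}. c v * (real_of_int (u $ j) * real_of_int (v $ j)))"
    by (rule sum.swap)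
  also have "\<dots> = (\<Sum>v\<in>T. c v * real_of_int (u \<bullet> v))"
  proof (rule sum.cong[OF refl])
    fix v assume "v \<in> T"
    then have "dim_vec v = m" using assms by auto
    then show "(\<Sum>j\<in>{0..<m}. c v * (real_of_int (u $ j) * real_of_int (v $ j)))
             = c v * real_of_int (u \<bullet> v)"
      by (simp add: scalar_prod_def sum_distrib_left)
  qed
  finally show ?thesis .
qed

lemma dual_monoid_cone:
  assumes "finite T" "T \<subseteq> carrier_vec m"
  shows "dual_monoid m (cone_spanned m T) = nonneg_on m T"
proof (intro equalityI subsetI)
  fix u assume u: "u \<in> dual_monoid m (cone_spanned m T)"
  then have uc: "u \<in> carrier_vec m" by (simp add: dual_monoid_def)
  have "u \<bullet> v \<ge> 0" if v: "v \<in> T" for v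
  proof -
    let ?c = "\<lambda>w. if w = v then 1 else (0::real)"
    have "vec m (\<lambda>j. \<Sum>w\<in>T. ?c w * real_of_int (w $ j)) \<in> cone_spanned m T"
      unfolding cone_spanned_def by (rule CollectI, rule exI[of _ ?c]) simp
    then have "0 \<le> map_vec real_of_int u \<bullet> vec m (\<lambda>j. \<Sum>w\<in>T. ?c w * real_of_int (w $ j))"
      using u by (simp add: dual_monoid_def)
    also have "\<dots> = (\<Sum>w\<in>T. ?c w * real_of_int (u \<bullet> w))"
      by (rule scalar_prod_cone[OF uc assms(2)])
    also have "\<dots> = (\<Sum>w\<in>T. if w = v then real_of_int (u \<bullet> w) else 0)"
      by (rule sum.cong) auto
    also have "\<dots> = real_of_int (u \<bullet> v)" using v assms(1) by simp
    finally show ?thesis by simp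
  qed
  then show "u \<in> nonneg_on m T" using uc by (simp add: nonneg_on_def)
next
  fix u assume u: "u \<in> nonneg_on m T"
  then have uc: "u \<in> carrier_vec m" by (simp add: nonneg_on_def)
  show "u \<in> dual_monoid m (cone_spanned m T)"
    using u unfolding dual_monoid_def cone_spanned_def
    by (auto simp: scalar_prod_cone[OF uc assms(2)] nonneg_on_def intro!: sum_nonneg mult_nonneg_nonneg)
qed

lemma topspace_toric_variety: "topspace (toric_variety m \<Sigma>) = toric_points m \<Sigma>"
proof -
  have "x \<in> \<Union>{{x \<in> toric_points m \<Sigma>. \<exists>z\<in>V. x u = Some z} | u V. u \<in> carrier_vec m \<and> open V}"
    if x: "x \<in> toric_points m \<Sigma>" for x
  proof -
    have "x (0\<^sub>v m) = Some 1" using x by (auto simp: toric_points_def)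
    with x have "x \<in> {x \<in> toric_points m \<Sigma>. \<exists>z\<in>UNIV. x (0\<^sub>v m) = Some z}" by auto
    moreover have "0\<^sub>v m \<in> carrier_vec m" "open (UNIV :: complex set)" by auto
    ultimately show ?thesis by blast
  qed
  then show ?thesis unfolding toric_variety_def topology_generated_by_topspace by blast
qed

lemma dom_toric_points:
  assumes "\<And>\<sigma>. \<sigma> \<in> \<Sigma> \<Longrightarrow> \<sigma> \<subseteq> carrier_vec m"
  shows "dom ` toric_points m \<Sigma> = dual_monoid m ` \<Sigma>"
proof (intro equalityI subsetI)
  fix D assume "D \<in> dom ` toric_points m \<Sigma>"
  then show "D \<in> dual_monoid m ` \<Sigma>" by (auto simp: toric_points_def)
next
  fix D assume "D \<in> dual_monoid m ` \<Sigma>"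
  then obtain \<sigma> where \<sigma>: "\<sigma> \<in> \<Sigma>" "D = dual_monoid m \<sigma>" by auto
  define x :: "int vec \<Rightarrow> complex option" where
    "x = (\<lambda>u. if u \<in> D then Some (if u \<in> perp_lattice m \<sigma> then 1 else 0) else None)"
  have dom: "dom x = D" by (auto simp: x_def dom_def)
  have add: "map_vec real_of_int (u + w) \<bullet> p
           = map_vec real_of_int u \<bullet> p + map_vec real_of_int w \<bullet> p"
    if "u \<in> carrier_vec m" "w \<in> carrier_vec m" "p \<in> carrier_vec m" for u w p
    using that by (auto simp: scalar_prod_def sum.distrib algebra_simps)
  have cl: "u + w \<in> D" "u + w \<in> perp_lattice m \<sigma> \<longleftrightarrow> u \<in> perp_lattice m \<sigma> \<and> w \<in> perp_lattice m \<sigma>"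
    if "u \<in> D" "w \<in> D" for u w
  proof -
    have c: "u \<in> carrier_vec m" "w \<in> carrier_vec m"
      and n: "\<And>p. p \<in> \<sigma> \<Longrightarrow> map_vec real_of_int u \<bullet> p \<ge> 0" "\<And>p. p \<in> \<sigma> \<Longrightarrow> map_vec real_of_int w \<bullet> p \<ge> 0"
      using that \<sigma> by (auto simp: dual_monoid_def)
    have a: "map_vec real_of_int (u + w) \<bullet> p = map_vec real_of_int u \<bullet> p + map_vec real_of_int w \<bullet> p"
      if "p \<in> \<sigma>" for p
      using add c assms \<sigma>(1) that by blast
    show "u + w \<in> D" using c n a \<sigma>(2) by (simp add: dual_monoid_def)
    show "u + w \<in> perp_lattice m \<sigma> \<longleftrightarrow> u \<in> perp_lattice m \<sigma> \<and> w \<in> perp_lattice m \<sigma>"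
      using c n a by (auto simp: perp_lattice_def add_nonneg_eq_0_iff)
  qed
  have z: "map_vec real_of_int (0\<^sub>v m) \<bullet> p = 0" if "p \<in> \<sigma>" for p
    using assms[OF \<sigma>(1)] that by (auto simp: scalar_prod_def)
  have "x (0\<^sub>v m) = Some 1"
    using \<sigma> z by (auto simp: x_def dual_monoid_def perp_lattice_def)
  moreover have "\<forall>u\<in>dom x. \<forall>w\<in>dom x. x (u + w) = Some (the (x u) * the (x w))"
    unfolding dom using cl by (auto simp: x_def)
  moreover have "\<forall>u\<in>dom x. x u \<noteq> Some 0 \<longleftrightarrow> u \<in> perp_lattice m \<sigma>"
    unfolding dom by (auto simp: x_def)
  ultimately have "x \<in> toric_points m \<Sigma>"
    unfolding toric_points_def using dom \<sigma> by blast
  then show "D \<in> dom ` toric_points m \<Sigma>" using dom by blast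
qed

lemma bott_rays_carrier:
  assumes "bott_matrix m B"
  shows "dim_row B = m" "finite (bott_rays B)" "bott_rays B \<subseteq> carrier_vec m"
  using assms by (auto simp: bott_matrix_def bott_rays_def)

lemma bott_matrix_col:
  assumes "bott_matrix m B"
  shows "k < m \<Longrightarrow> col B k $ k = -1" "\<lbrakk>j < k; k < m\<rbrakk> \<Longrightarrow> col B k $ j = 0"
proof -
  have d: "dim_row B = m" "dim_col B = m" using assms by (auto simp: bott_matrix_def)
  show "k < m \<Longrightarrow> col B k $ k = -1" "\<lbrakk>j < k; k < m\<rbrakk> \<Longrightarrow> col B k $ j = 0"
    using assms by (auto simp: bott_matrix_def col_def d)
qed

lemma dom_bott_manifold:
  assumes "bott_matrix m B"
  shows "dom ` topspace (bott_manifold B) = {nonneg_on m T | T S. T \<subseteq> S \<and> bott_maximal B S}"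
proof -
  note r = bott_rays_carrier[OF assms]
  have T: "finite T" "T \<subseteq> carrier_vec m" if "T \<subseteq> S" "bott_maximal B S" for T S
  proof -
    have "T \<subseteq> bott_rays B" using that by (auto simp: bott_maximal_def)
    then show "finite T" "T \<subseteq> carrier_vec m"
      using r(3) finite_subset[OF _ r(2)] by auto
  qed
  have "dom ` topspace (bott_manifold B) = dual_monoid m ` bott_fan B"
    unfolding bott_manifold_def topspace_toric_variety r(1)
    by (rule dom_toric_points) (auto simp: bott_fan_def cone_spanned_def r(1))
  also have "\<dots> = {dual_monoid m (cone_spanned m T) | T S. T \<subseteq> S \<and> bott_maximal B S}"
    unfolding bott_fan_def r(1) by blast
  also have "\<dots> = {nonneg_on m T | T S. T \<subseteq> S \<and> bott_maximal B S}"
  proof -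
    have "dual_monoid m (cone_spanned m T) = nonneg_on m T" if "T \<subseteq> S \<and> bott_maximal B S" for T S
      using dual_monoid_cone[OF T(1)[of T S] T(2)[of T S]] that by simp
    then show ?thesis by (intro Collect_cong ex_cong1) metis
  qed
  finally show ?thesis .
qed

lemma bott_maximal_single:
  assumes B: "bott_matrix m B" and i: "i < m"
  shows "bott_maximal B (insert (col B i) (unit_vec m ` ({..<m} - {i})))"
proof -
  note r = bott_rays_carrier[OF B]
  have diag: "col B k $ k = -1" if "k < m" for k
    by (rule bott_matrix_col(1)[OF B that])
  have ne: "col B k \<noteq> unit_vec m l" if "k < m" "l < m" for k l
  proof
    assume "col B k = unit_vec m l"
    then have "unit_vec m l $ k = (-1::int)" using diag[OF that(1)] by simp
    then show False using that by (auto split: if_splits)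
  qed
  have inj: "inj_on (unit_vec m :: nat \<Rightarrow> int vec) {..<m}"
  proof (rule inj_onI)
    fix k l assume "k \<in> {..<m}" "l \<in> {..<m}" "(unit_vec m k :: int vec) = unit_vec m l"
    then have "(unit_vec m k :: int vec) $ k = unit_vec m l $ k" by simp
    then show "k = l" using \<open>k \<in> _\<close> \<open>l \<in> _\<close> by (auto split: if_splits)
  qed
  have cinj: "unit_vec m i \<notin> unit_vec m ` ({..<m} - {i}) \<and>
       unit_vec m i \<noteq> col B i"
    using inj i ne[OF i i] by (auto simp: inj_on_def) 
  have "card (unit_vec m ` ({..<m} - {i}) :: int vec set) = m - 1"
    using inj i by (subst card_image) (auto intro: inj_on_subset)
  moreover have "col B i \<notin> unit_vec m ` ({..<m} - {i})" using ne[OF i] by auto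
  ultimately have card: "card (insert (col B i) (unit_vec m ` ({..<m} - {i}))) = m"
    using i by simp
  have "\<not> {unit_vec m k, col B k} \<subseteq> insert (col B i) (unit_vec m ` ({..<m} - {i}))"
    if k: "k < m" for k
  proof
    assume a: "{unit_vec m k, col B k} \<subseteq> insert (col B i) (unit_vec m ` ({..<m} - {i}))"
    then have mem: "(unit_vec m k :: int vec) \<in> unit_vec m ` ({..<m} - {i})"
      using ne[OF i k] by (metis insert_iff insert_subset)
    have "k \<noteq> i" using cinj mem by blast
    have "col B k \<notin> unit_vec m ` ({..<m} - {i})" using ne[OF k] by auto
    then have "col B k = col B i" using a by blast
    then have "col B i $ k = -1" "col B k $ i = -1" using diag[OF k] diag[OF i] by simp_all
    then show False
      using bott_matrix_col(2)[OF B, of i k] bott_matrix_col(2)[OF B, of k i] i k \<open>k \<noteq> i\<close>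
      by (cases "i < k") auto
  qed
  then show ?thesis
    unfolding bott_maximal_def using card i by (auto simp: r(1) bott_rays_def)
qed

lemma bott_manifold_determines_column:
  assumes B: "bott_matrix m B" and B': "bott_matrix m B'"
    and eq: "bott_manifold B = bott_manifold B'" and i: "i < m"
  shows "col B i = col B' i"
proof -
  let ?v = "col B i"
  note r = bott_rays_carrier[OF B']
  have dims: "dim_row B = m" "dim_col B = m" "dim_row B' = m" "dim_col B' = m"
    using B B' by (auto simp: bott_matrix_def)
  have vc: "?v \<in> carrier_vec m" by (rule carrier_vecI) (simp add: dims)
  have vi: "?v $ i = -1" using bott_matrix_col(1)[OF B i] .
  have "nonneg_on m {?v} \<in> dom ` topspace (bott_manifold B)"
    unfolding dom_bott_manifold[OF B]
    using bott_maximal_single[OF B i] by blast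
  then have "nonneg_on m {?v} \<in> dom ` topspace (bott_manifold B')"
    by (simp only: eq)
  then obtain T where T: "nonneg_on m {?v} = nonneg_on m T" "T \<subseteq> bott_rays B'"
    unfolding dom_bott_manifold[OF B'] bott_maximal_def by auto
  have vv: "?v \<bullet> ?v > 0"
  proof -
    have "0 < ?v $ i * ?v $ i" using vi by simp
    also have "\<dots> \<le> (\<Sum>j\<in>{0..<m}. ?v $ j * ?v $ j)"
      using i by (intro member_le_sum[of i "{0..<m}" "\<lambda>j. ?v $ j * ?v $ j"]) auto
    finally show ?thesis using dims by (simp add: scalar_prod_def)
  qed
  have "- ?v \<notin> nonneg_on m {?v}" "- ?v \<in> nonneg_on m {}"
    using vv vc by (auto simp: nonneg_on_def)
  then have "T \<noteq> {}" using T(1) by metis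
  then obtain w where w: "w \<in> T" by auto
  then have wr: "w \<in> bott_rays B'" and wc: "w \<in> carrier_vec m" using T r by auto
  have orth: "u \<bullet> w = 0" if u: "u \<in> carrier_vec m" "u \<bullet> ?v = 0" for u
  proof -
    have "dim_vec u = m" "dim_vec ?v = m" "dim_vec w = m" using u(1) vc wc by (auto simp: dims)
    then have nu: "- u \<bullet> ?v = - (u \<bullet> ?v)" "- u \<bullet> w = - (u \<bullet> w)" by (simp_all del: dim_col)
    have "u \<in> nonneg_on m {?v}" "- u \<in> nonneg_on m {?v}"
      using u nu(1) by (auto simp: nonneg_on_def)
    then have "u \<bullet> w \<ge> 0" "(- u) \<bullet> w \<ge> 0" using T(1) w by (auto simp: nonneg_on_def)
    then show ?thesis using nu(2) by simp
  qed
  have pr: "w $ j = - (w $ i) * ?v $ j" if j: "j < m" for j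
  proof -
    let ?u = "(?v $ j) \<cdot>\<^sub>v unit_vec m i + unit_vec m j"
    have sp: "?u \<bullet> y = ?v $ j * y $ i + y $ j" if "y \<in> carrier_vec m" for y
      using that i j by (simp add: add_scalar_prod_distrib[of _ m])
    have "?u \<bullet> ?v = 0" using sp[OF vc] vi by simp
    then have "?u \<bullet> w = 0" using orth by simp
    then show ?thesis using sp[OF wc] by (simp add: algebra_simps)
  qed
  have weq: "w = (- (w $ i)) \<cdot>\<^sub>v ?v"
    using wc vc pr dims by (intro eq_vecI) auto
  have "?v \<in> nonneg_on m T" using vv vc T(1) by (auto simp: nonneg_on_def)
  then have "?v \<bullet> w \<ge> 0" using w by (auto simp: nonneg_on_def)
  moreover have "?v \<bullet> w = - (w $ i) * (?v \<bullet> ?v)"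
    using vc by (subst weq) simp
  ultimately have "w $ i \<le> 0" using vv by (simp add: zero_le_mult_iff mult_le_0_iff)
  moreover have "w $ i \<noteq> 0"
  proof
    assume w0: "w $ i = 0"
    from wr consider k where "k < m" "w = unit_vec m k" | k where "k < m" "w = col B' k"
      unfolding bott_rays_def using dims by auto
    then have "\<exists>k<m. w $ k \<noteq> 0"
    proof cases
      case 1 then show ?thesis by (intro exI[of _ k]) auto
    next
      case 2 then show ?thesis using bott_matrix_col(1)[OF B'] by (intro exI[of _ k]) auto
    qed
    then show False using pr w0 by auto
  qed
  ultimately have neg: "w $ i < 0" by simp
  then have "w \<notin> unit_vec m ` {..<m}" using i by (auto split: if_splits)
  then obtain k where k: "k < m" "w = col B' k" using wr dims by (auto simp: bott_rays_def)
  have "k \<le> i"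
    using neg k bott_matrix_col(2)[OF B', of i k] by (cases "i < k") auto
  moreover have "i \<le> k"
  proof (rule ccontr)
    assume "\<not> i \<le> k"
    then have "?v $ k = 0" using bott_matrix_col(2)[OF B, of k i] i by simp
    then have "w $ k = 0" using pr[OF k(1)] by simp
    then show False using k bott_matrix_col(1)[OF B'] by simp
  qed
  ultimately have "k = i" by simp
  then have "w $ i = -1" using k bott_matrix_col(1)[OF B'] by simp
  then show ?thesis using weq k \<open>k = i\<close> by simp
qed

theorem bott_manifold_eq_iff:
  assumes B: "bott_matrix m B" and B': "bott_matrix m B'"
  shows "bott_manifold B = bott_manifold B' \<longleftrightarrow> B = B'"
proof
  assume eq: "bott_manifold B = bott_manifold B'"
  have dims: "dim_row B = m" "dim_col B = m" "dim_row B' = m" "dim_col B' = m"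
    using B B' by (auto simp: bott_matrix_def)
  show "B = B'"
    using bott_manifold_determines_column[OF B B' eq] dims
    by (intro mat_col_eqI) auto
qed simp


section \<open>Assemblies of ordered partitions\<close>

type_synonym ordered_partition = "nat set list"

definition is_ordered_partition :: "ordered_partition \<Rightarrow> bool" where
  "is_ordered_partition \<tau> \<longleftrightarrow>
     (\<forall>A\<in>set \<tau>. A \<noteq> {}) \<and> (\<forall>p q. p < q \<and> q < length \<tau> \<longrightarrow> \<tau> ! p \<inter> \<tau> ! q = {})"

definition underlying :: "ordered_partition \<Rightarrow> nat set" where
  "underlying \<tau> = \<Union>(set \<tau>)"

text \<open>
  Strict increase of the minima makes the sets \<open>underlying (\<sigma> ! a)\<close> distinct, so that being a partition
  as a set of sets is the same as being one as a family.
\<close>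

definition is_assembly :: "nat \<Rightarrow> ordered_partition list \<Rightarrow> bool" where
  "is_assembly m \<sigma> \<longleftrightarrow>
     (\<forall>\<tau>\<in>set \<sigma>. is_ordered_partition \<tau>) \<and>
     partition_on {1..m} (underlying ` set \<sigma>) \<and>
     (\<forall>a b. a < b \<and> b < length \<sigma> \<longrightarrow> Min (underlying (\<sigma> ! a)) < Min (underlying (\<sigma> ! b)))"

text \<open>For \<open>m > 0\<close> an assembly is nonempty, so the truncated subtraction is exact.\<close>

definition AOP :: "nat \<Rightarrow> nat \<Rightarrow> ordered_partition list set" where
  "AOP n m = {\<sigma>. is_assembly m \<sigma> \<and> (\<Sum>a<length \<sigma>. length (\<sigma> ! a)) + (length \<sigma> - 1) \<le> n}"

definition AOP_equiv :: "nat \<Rightarrow> nat \<Rightarrow> (ordered_partition list \<times> ordered_partition list) set" where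
  "AOP_equiv n m = {(\<sigma>, \<tau>). \<sigma> \<in> AOP n m \<and> \<tau> \<in> AOP n m \<and> length \<sigma> = length \<tau> \<and>
     (\<forall>a<length \<sigma>. \<tau> ! a = \<sigma> ! a \<or> \<tau> ! a = rev (\<sigma> ! a))}"

lemma equiv_AOP_equiv: "equiv (AOP n m) (AOP_equiv n m)"
proof (rule equivI)
  show "AOP_equiv n m \<subseteq> AOP n m \<times> AOP n m" by (auto simp: AOP_equiv_def)
  show "refl_on (AOP n m) (AOP_equiv n m)" by (auto simp: AOP_equiv_def refl_on_def)
  show "sym (AOP_equiv n m)" by (auto simp: AOP_equiv_def sym_def)
  show "trans (AOP_equiv n m)"
    unfolding AOP_equiv_def trans_def by (clarsimp; metis rev_rev_ident)
qed

end

theory Submission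
  imports Defs
begin

text \<open>
  Bott manifolds are equal exactly when their matrices are, and the matrix of a word records for each
  pair of positions only whether the two letters are equal (distance 0) or consecutive (distance 1).
  Listing the level sets of the word by letter and cutting the list at the letters that do not occur
  gives an assembly with the same data, where distance is that of blocks within one ordered partition;
  conversely the ordered partitions, concatenated with empty separators, are the level sets of a word.
  These data determine the assembly up to reversing its parts: the underlying sets are the connected
  components of the relation "distance at most 1", the blocks are the classes of "distance 0", and a
  path is determined up to reversal by its adjacency relation.
\<close>

section \<open>Distances between blocks of a list\<close>

text \<open>The positions are existentially quantified, so the notion makes sense for any list; once
  the blocks are disjoint it is the distance between the two blocks. Only the values 0 and 1 matter,
  since the Bott matrix of a word sees no others.\<close>

definition at_dist :: "int \<Rightarrow> 'a set list \<Rightarrow> 'a \<Rightarrow> 'a \<Rightarrow> bool" where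
  "at_dist d L x y \<longleftrightarrow>
     (\<exists>p<length L. \<exists>q<length L. \<bar>int p - int q\<bar> = d \<and> x \<in> L ! p \<and> y \<in> L ! q)"

lemma at_dist_Nil [simp]: "\<not> at_dist d [] x y"
  by (simp add: at_dist_def)

lemma at_dist_members:
  assumes "at_dist d L x y"
  shows "x \<in> \<Union>(set L)" "y \<in> \<Union>(set L)"
  using assms by (auto simp: at_dist_def)

text \<open>An empty block contains no element, and positions on opposite sides of it differ by at
  least 2. So distances up to 1 never cross it, which makes \<open>{}\<close> usable as a separator
  between parts.\<close>

lemma at_dist_append_gap:
  assumes "d \<le> 1"
  shows "at_dist d (L @ {} # L') x y \<longleftrightarrow> at_dist d L x y \<or> at_dist d L' x y"
proof
  assume "at_dist d (L @ {} # L') x y"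
  then obtain p q where pq: "p < length (L @ {} # L')" "q < length (L @ {} # L')"
      "\<bar>int p - int q\<bar> = d" "x \<in> (L @ {} # L') ! p" "y \<in> (L @ {} # L') ! q"
    unfolding at_dist_def by blast
  have ne: "p \<noteq> length L" "q \<noteq> length L" using pq(4,5) by auto
  consider "p < length L" "q < length L" | "p > length L" "q > length L"
    using ne pq(3) assms by linarith
  then show "at_dist d L x y \<or> at_dist d L' x y"
  proof cases
    case 1
    then show ?thesis using pq unfolding at_dist_def by (metis nth_append)
  next
    case 2
    define p' q' where "p' = p - Suc (length L)" and "q' = q - Suc (length L)"
    have "p = Suc (length L) + p'" "q = Suc (length L) + q'"
      using 2 by (simp_all add: p'_def q'_def)
    then have "at_dist d L' x y"
      using pq unfolding at_dist_def
      by (intro exI[of _ p'] exI[of _ q']) (auto simp: nth_append)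
    then show ?thesis ..
  qed
next
  assume "at_dist d L x y \<or> at_dist d L' x y"
  then show "at_dist d (L @ {} # L') x y"
  proof
    assume "at_dist d L x y"
    then obtain p q where "p < length L" "q < length L" "\<bar>int p - int q\<bar> = d" "x \<in> L ! p" "y \<in> L ! q"
      unfolding at_dist_def by blast
    then show ?thesis
      unfolding at_dist_def by (intro exI[of _ p] exI[of _ q]) (auto simp: nth_append)
  next
    assume "at_dist d L' x y"
    then obtain p q where "p < length L'" "q < length L'" "\<bar>int p - int q\<bar> = d" "x \<in> L' ! p" "y \<in> L' ! q"
      unfolding at_dist_def by blast
    then have "Suc (length L) + p < length (L @ {} # L')" "Suc (length L) + q < length (L @ {} # L')"
      "\<bar>int (Suc (length L) + p) - int (Suc (length L) + q)\<bar> = d"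
      "x \<in> (L @ {} # L') ! (Suc (length L) + p)" "y \<in> (L @ {} # L') ! (Suc (length L) + q)"
      by (simp_all add: nth_append)
    then show ?thesis unfolding at_dist_def by blast
  qed
qed

text \<open>Mirroring positions, \<open>p\<close> to \<open>length L - Suc p\<close>, keeps
  differences up to sign; hence distances cannot tell a part from its reversal.\<close>

lemma at_dist_rev: "at_dist d (rev L) x y \<longleftrightarrow> at_dist d L x y"
proof -
  have *: "at_dist d (rev L) x y" if L: "at_dist d L x y" for L
  proof -
    obtain p q where "p < length L" "q < length L" "\<bar>int p - int q\<bar> = d" "x \<in> L ! p" "y \<in> L ! q"
      using L unfolding at_dist_def by blast
    then have "length L - Suc p < length (rev L)" "length L - Suc q < length (rev L)"
      "\<bar>int (length L - Suc p) - int (length L - Suc q)\<bar> = d"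
      "x \<in> rev L ! (length L - Suc p)" "y \<in> rev L ! (length L - Suc q)"
      by (auto simp: rev_nth Suc_diff_Suc)
    then show ?thesis unfolding at_dist_def by blast
  qed
  then show ?thesis by (metis rev_rev_ident)
qed

text \<open>\<open>sorted_wrt disjnt\<close> is disjointness by position: a nonempty block cannot
  occur twice, but the empty set can, as it must for separators and absent letters.\<close>

lemma sorted_wrt_disjnt_index_eq:
  assumes "sorted_wrt disjnt L" "p < length L" "q < length L" "x \<in> L ! p" "x \<in> L ! q"
  shows "p = q"
proof (rule ccontr)
  assume "p \<noteq> q"
  then have "disjnt (L ! p) (L ! q) \<or> disjnt (L ! q) (L ! p)"
    using assms(1-3) by (auto simp: sorted_wrt_iff_nth_less neq_iff)
  then show False using assms(4,5) by (auto simp: disjnt_iff)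
qed

lemma at_dist_disjnt:
  assumes "sorted_wrt disjnt L" "p < length L" "q < length L" "x \<in> L ! p" "y \<in> L ! q"
  shows "at_dist d L x y \<longleftrightarrow> \<bar>int p - int q\<bar> = d"
proof
  assume "at_dist d L x y"
  then obtain p' q' where *: "p' < length L" "q' < length L" "\<bar>int p' - int q'\<bar> = d" "x \<in> L ! p'" "y \<in> L ! q'"
    unfolding at_dist_def by blast
  then have "p' = p" "q' = q" using assms by (auto intro: sorted_wrt_disjnt_index_eq)
  with * show "\<bar>int p - int q\<bar> = d" by simp
next
  assume "\<bar>int p - int q\<bar> = d"
  with assms(2-) show "at_dist d L x y" unfolding at_dist_def by blast
qed

section \<open>Ordered partitions and assemblies as disjoint lists\<close>

text \<open>A nonempty set meets itself, so disjointness by position rules out repetitions. The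
  right-hand side does not depend on the order of the list, so disjointness survives
  sorting.\<close>

lemma sorted_wrt_disjnt_iff:
  assumes "{} \<notin> set L"
  shows "sorted_wrt disjnt L \<longleftrightarrow> distinct L \<and> disjoint (set L)"
  using assms
proof (induction L)
  case (Cons A L)
  have "(\<forall>B\<in>set L. disjnt A B) \<and> disjoint (set L) \<longleftrightarrow> A \<notin> set L \<and> disjoint (insert A (set L))"
    using Cons.prems by (auto simp: pairwise_insert disjnt_sym)
  with Cons show ?case by auto
qed simp

lemma is_ordered_partition_iff:
  "is_ordered_partition \<tau> \<longleftrightarrow> {} \<notin> set \<tau> \<and> sorted_wrt disjnt \<tau>"
  by (auto simp: is_ordered_partition_def sorted_wrt_iff_nth_less disjnt_def)

lemma inj_on_Min_disjoint:
  fixes P :: "nat set set"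
  assumes "disjoint P" "\<And>A. A \<in> P \<Longrightarrow> finite A \<and> A \<noteq> {}"
  shows "inj_on Min P"
proof (rule inj_onI)
  fix A B assume "A \<in> P" "B \<in> P" and eq: "Min A = Min B"
  have Min_mem: "Min C \<in> C" if "C \<in> P" for C using assms(2)[OF that] by (intro Min_in) simp_all
  have "Min A \<in> A" by (rule Min_mem) fact
  moreover have "Min A \<in> B" unfolding eq by (rule Min_mem) fact
  ultimately show "A = B" using assms(1) \<open>A \<in> P\<close> \<open>B \<in> P\<close> by (meson disjnt_iff pairwiseD)
qed

text \<open>Strict increase of the minima splits into weak increase and distinctness.
  \<open>Min\<close> is injective on a disjoint family of finite nonempty sets, so this distinctness
  is that of the underlying sets and turns the partition condition into disjointness by position.
  What remains is plain \<open>sorted\<close>, which \<open>sort_key\<close> supplies.\<close>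

lemma is_assembly_iff:
  "is_assembly m \<sigma> \<longleftrightarrow>
     (\<forall>\<tau>\<in>set \<sigma>. is_ordered_partition \<tau>) \<and> {} \<notin> underlying ` set \<sigma> \<and>
     \<Union>(underlying ` set \<sigma>) = {1..m} \<and>
     sorted_wrt disjnt (map underlying \<sigma>) \<and> sorted (map (Min \<circ> underlying) \<sigma>)"
  (is "?l \<longleftrightarrow> ?r")
proof -
  have strict: "(\<forall>a b. a < b \<and> b < length \<sigma> \<longrightarrow> Min (underlying (\<sigma> ! a)) < Min (underlying (\<sigma> ! b)))
      \<longleftrightarrow> sorted (map (Min \<circ> underlying) \<sigma>) \<and> distinct (map (Min \<circ> underlying) \<sigma>)"
    (is "?l \<longleftrightarrow> _")
  proof -
    have "?l \<longleftrightarrow> sorted_wrt (<) (map (Min \<circ> underlying) \<sigma>)"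
      by (auto simp: sorted_wrt_iff_nth_less)
    then show ?thesis by (simp only: strict_sorted_iff)
  qed
  have "distinct (map (Min \<circ> underlying) \<sigma>) \<longleftrightarrow> distinct (map underlying \<sigma>)"
    if d: "disjoint (underlying ` set \<sigma>)" and ne: "{} \<notin> underlying ` set \<sigma>"
      and U: "\<Union>(underlying ` set \<sigma>) = {1..m}"
  proof -
    have "finite A \<and> A \<noteq> {}" if "A \<in> underlying ` set \<sigma>" for A
      using that ne U by (metis Union_upper finite_atLeastAtMost finite_subset)
    then have "inj_on Min (set (map underlying \<sigma>))"
      using inj_on_Min_disjoint[OF d] by simp
    then have "distinct (map Min (map underlying \<sigma>)) \<longleftrightarrow> distinct (map underlying \<sigma>)"
      by (metis distinct_map)
    then show ?thesis by simp
  qed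
  then show ?thesis
    unfolding is_assembly_def strict partition_on_def using sorted_wrt_disjnt_iff[of "map underlying \<sigma>"]
    by auto
qed

section \<open>Concatenation with empty separators\<close>

text \<open>A separator follows every part, also the last one; this keeps the recursion uniform at
  the price of one extra entry.\<close>

definition flat :: "'a set list list \<Rightarrow> 'a set list" where
  "flat \<sigma> = concat (map (\<lambda>\<tau>. \<tau> @ [{}]) \<sigma>)"

lemma flat_simps [simp]: "flat [] = []" "flat (\<tau> # \<sigma>) = \<tau> @ {} # flat \<sigma>"
  by (simp_all add: flat_def)

lemma length_flat: "length (flat \<sigma>) = (\<Sum>\<tau>\<leftarrow>\<sigma>. length \<tau>) + length \<sigma>"
  by (induction \<sigma>) auto

lemma Union_flat: "\<Union>(set (flat \<sigma>)) = \<Union>(underlying ` set \<sigma>)"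
  by (induction \<sigma>) (auto simp: underlying_def)

lemma last_flat: "\<sigma> \<noteq> [] \<Longrightarrow> last (flat \<sigma>) = {}"
proof (induction \<sigma>)
  case (Cons \<tau> \<sigma>)
  then show ?case by (cases \<sigma>) auto
qed simp

lemma at_dist_flat: "d \<le> 1 \<Longrightarrow> at_dist d (flat \<sigma>) x y \<longleftrightarrow> (\<exists>\<tau>\<in>set \<sigma>. at_dist d \<tau> x y)"
  by (induction \<sigma>) (auto simp: at_dist_append_gap)

lemma sorted_wrt_disjnt_flat:
  "sorted_wrt disjnt (flat \<sigma>) \<longleftrightarrow>
     (\<forall>\<tau>\<in>set \<sigma>. sorted_wrt disjnt \<tau>) \<and> sorted_wrt disjnt (map underlying \<sigma>)"
proof (induction \<sigma>)
  case (Cons \<tau> \<sigma>)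
  have "(\<forall>A\<in>set \<tau>. \<forall>B\<in>set (flat \<sigma>). disjnt A B) \<longleftrightarrow> disjnt (\<Union>(set \<tau>)) (\<Union>(set (flat \<sigma>)))"
    by (auto simp: disjnt_iff)
  also have "\<dots> \<longleftrightarrow> (\<forall>\<rho>\<in>set \<sigma>. disjnt (underlying \<tau>) (underlying \<rho>))"
    unfolding Union_flat by (auto simp: disjnt_iff underlying_def)
  finally show ?case
    using Cons by (auto simp: sorted_wrt_append)
qed simp

text \<open>The bound counts the blocks and the separators strictly between parts; the trailing
  separator accounts for the \<open>Suc\<close>.\<close>

lemma AOP_bound_iff:
  assumes "\<sigma> \<noteq> []"
  shows "(\<Sum>a<length \<sigma>. length (\<sigma> ! a)) + (length \<sigma> - 1) \<le> n \<longleftrightarrow> length (flat \<sigma>) \<le> Suc n"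
proof -
  have "(\<Sum>a<length \<sigma>. length (\<sigma> ! a)) = (\<Sum>\<tau>\<leftarrow>\<sigma>. length \<tau>)"
    by (simp add: sum_list_sum_nth atLeast0LessThan)
  then show ?thesis using assms by (cases \<sigma>) (auto simp: length_flat)
qed

section \<open>Words and assemblies with the same distances\<close>

text \<open>A relation, not a function: a word shares its distances with all reversals of parts, and
  an assembly may come from several words. Elements count from 1 and list positions from 0, hence
  \<open>x - 1\<close>.\<close>

definition realizes :: "nat list \<Rightarrow> ordered_partition list \<Rightarrow> bool" where
  "realizes w \<sigma> \<longleftrightarrow> (\<forall>d\<in>{0, 1}. \<forall>x\<in>{1..length w}. \<forall>y\<in>{1..length w}.
     (\<exists>\<tau>\<in>set \<sigma>. at_dist d \<tau> x y) \<longleftrightarrow> \<bar>int (w ! (x - 1)) - int (w ! (y - 1))\<bar> = d)"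

lemma AOP_nonempty: "\<sigma> \<in> AOP n m \<Longrightarrow> m > 0 \<Longrightarrow> \<sigma> \<noteq> []"
  by (auto simp: AOP_def is_assembly_iff)

text \<open>The letter at \<open>x\<close> is the position of its block in the concatenated list,
  counted from 1.\<close>

lemma AOP_realized:
  assumes \<sigma>: "\<sigma> \<in> AOP n m" and m: "m > 0"
  shows "\<exists>w\<in>words n m. realizes w \<sigma>"
proof -
  have ne: "\<sigma> \<noteq> []" using AOP_nonempty \<sigma> m by blast
  have asm: "is_assembly m \<sigma>" using \<sigma> by (simp add: AOP_def)
  define L where "L = flat \<sigma>"
  have disj: "sorted_wrt disjnt L" and U: "\<Union>(set L) = {1..m}"
    using asm unfolding L_def sorted_wrt_disjnt_flat Union_flat is_assembly_iff is_ordered_partition_iff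
    by blast+
  have len: "length L \<le> Suc n"
    using \<sigma> AOP_bound_iff[OF ne] by (simp add: AOP_def L_def)
  have "\<exists>p<length L. x \<in> L ! p" if "x \<in> {1..m}" for x
    using that U by (metis UnionE in_set_conv_nth)
  then obtain f where f: "\<And>x. x \<in> {1..m} \<Longrightarrow> f x < length L \<and> x \<in> L ! f x" by metis
  \<comment> \<open>The list may have \<open>n + 1\<close> entries, but its last one is an empty
    separator and contains no \<open>x\<close>, so one position is saved.\<close>
  have fn: "f x < n" if x: "x \<in> {1..m}" for x
  proof -
    have "L \<noteq> []" using f[OF x] by auto
    then have "L ! (length L - 1) = {}"
      using last_flat[OF ne] by (metis L_def last_conv_nth)
    then have "f x \<noteq> length L - 1" using f[OF x] by auto
    then show ?thesis using f[OF x] len by linarith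
  qed
  define w where "w = map (\<lambda>i. Suc (f (Suc i))) [0..<m]"
  have lw: "length w = m" by (simp add: w_def)
  have wx: "w ! (x - 1) = Suc (f x)" if "x \<in> {1..m}" for x
    using that by (auto simp: w_def)
  have "w \<in> words n m"
    using fn by (auto simp: words_def w_def Suc_le_eq)
  moreover have "realizes w \<sigma>"
    unfolding realizes_def lw
  proof (intro ballI)
    fix d :: int and x y assume d: "d \<in> {0, 1}" and x: "x \<in> {1..m}" and y: "y \<in> {1..m}"
    have "(\<exists>\<tau>\<in>set \<sigma>. at_dist d \<tau> x y) \<longleftrightarrow> at_dist d L x y"
      using d by (subst L_def, subst at_dist_flat) auto
    also have "\<dots> \<longleftrightarrow> \<bar>int (f x) - int (f y)\<bar> = d"
      using f[OF x] f[OF y] by (intro at_dist_disjnt[OF disj]) auto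
    finally show "(\<exists>\<tau>\<in>set \<sigma>. at_dist d \<tau> x y) \<longleftrightarrow> \<bar>int (w ! (x - 1)) - int (w ! (y - 1))\<bar> = d"
      unfolding wx[OF x] wx[OF y] by simp
  qed
  ultimately show ?thesis by blast
qed

text \<open>Induction on the length, cutting at the first empty set. A nonempty initial segment
  becomes a part; an empty one is dropped, so leading or repeated gaps only shorten the result, and
  the trailing separator costs at most one entry.\<close>

lemma split_at_gaps:
  fixes L :: "'a set list"
  shows "\<exists>\<sigma>. [] \<notin> set \<sigma> \<and> (\<forall>\<tau>\<in>set \<sigma>. {} \<notin> set \<tau>) \<and> length (flat \<sigma>) \<le> Suc (length L) \<and>
     \<Union>(set (flat \<sigma>)) = \<Union>(set L) \<and> (sorted_wrt disjnt L \<longrightarrow> sorted_wrt disjnt (flat \<sigma>)) \<and>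
     (\<forall>d\<le>1. \<forall>x y. at_dist d (flat \<sigma>) x y \<longleftrightarrow> at_dist d L x y)"
proof (induction "length L" arbitrary: L rule: less_induct)
  case less
  show ?case
  proof (cases "{} \<in> set L")
    case False
    show ?thesis
    proof (cases "L = []")
      case True
      then show ?thesis by (intro exI[of _ "[]"]) auto
    next
      case ne: False
      have "at_dist d (L @ [{}]) x y \<longleftrightarrow> at_dist d L x y" if "d \<le> 1" for d x y
        using at_dist_append_gap[OF that, of L "[]"] by simp
      then show ?thesis
        using False ne by (intro exI[of _ "[L]"]) (auto simp: sorted_wrt_append)
    qed
  next
    case True
    then obtain K L' where L: "L = K @ {} # L'" "{} \<notin> set K"
      by (meson split_list_first)
    then obtain \<sigma> where \<sigma>: "[] \<notin> set \<sigma>" "\<forall>\<tau>\<in>set \<sigma>. {} \<notin> set \<tau>" "length (flat \<sigma>) \<le> Suc (length L')"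
     "\<Union>(set (flat \<sigma>)) = \<Union>(set L')" "sorted_wrt disjnt L' \<longrightarrow> sorted_wrt disjnt (flat \<sigma>)"
     "\<forall>d\<le>1. \<forall>x y. at_dist d (flat \<sigma>) x y \<longleftrightarrow> at_dist d L' x y"
      using less[of L'] by auto
    show ?thesis
    proof (cases "K = []")
      case True
      have "at_dist d ({} # L') x y \<longleftrightarrow> at_dist d L' x y" if "d \<le> 1" for d x y
        using at_dist_append_gap[OF that, of "[]" L'] by simp
      with True show ?thesis using \<sigma> L by (intro exI[of _ \<sigma>]) auto
    next
      case False
      \<comment> \<open>Disjointness from \<open>K\<close> depends only on the union of the
        remaining blocks, which \<open>flat \<sigma>\<close> shares with \<open>L'\<close>.\<close>
      have pairwise: "(\<forall>A\<in>set K. \<forall>B\<in>set M. disjnt A B) \<longleftrightarrow> disjnt (\<Union>(set K)) (\<Union>(set M))"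
        for M :: "'a set list"
        unfolding disjnt_iff by blast
      then have "(\<forall>A\<in>set K. \<forall>B\<in>set (flat \<sigma>). disjnt A B) \<longleftrightarrow> (\<forall>A\<in>set K. \<forall>B\<in>set L'. disjnt A B)"
        by (simp only: pairwise \<sigma>(4))
      then show ?thesis using \<sigma> L False
        by (intro exI[of _ "K # \<sigma>"]) (auto simp: sorted_wrt_append at_dist_append_gap)
    qed
  qed
qed

text \<open>The level sets listed by letter have the distances of the letters. Cutting at the gaps
  keeps distances up to 1, and sorting the parts by minima then yields an assembly.\<close>

lemma word_realizes:
  assumes w: "w \<in> words n m" and m: "m > 0"
  shows "\<exists>\<sigma>\<in>AOP n m. realizes w \<sigma>"
proof -
  have lw: "length w = m" and sw: "set w \<subseteq> {1..n}" using w by (auto simp: words_def)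
  \<comment> \<open>Position \<open>v\<close> holds the level set of the letter
    \<open>Suc v\<close>; a letter that does not occur leaves an empty set, where the list is
    cut.\<close>
  define L where "L = map (\<lambda>v. {x\<in>{1..m}. w ! (x - 1) = Suc v}) [0..<n]"
  have lL: "length L = n" and Ln: "\<And>v. v < n \<Longrightarrow> L ! v = {x\<in>{1..m}. w ! (x - 1) = Suc v}"
    by (simp_all add: L_def)
  have disj: "sorted_wrt disjnt L"
    by (auto simp: sorted_wrt_iff_nth_less lL Ln disjnt_iff)
  have wx: "w ! (x - 1) - 1 < n \<and> x \<in> L ! (w ! (x - 1) - 1) \<and> w ! (x - 1) > 0" if x: "x \<in> {1..m}" for x
  proof -
    have "w ! (x - 1) \<in> set w" using x lw by (intro nth_mem) auto
    then have "w ! (x - 1) \<in> {1..n}" using sw by blast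
    then show ?thesis using x Ln[of "w ! (x - 1) - 1"] by auto
  qed
  have U: "\<Union>(set L) = {1..m}"
  proof
    show "\<Union>(set L) \<subseteq> {1..m}" by (auto simp: L_def)
    show "{1..m} \<subseteq> \<Union>(set L)" using wx lL by (meson UnionI nth_mem subsetI)
  qed
  obtain \<sigma>0 where \<sigma>0: "[] \<notin> set \<sigma>0" "\<forall>\<tau>\<in>set \<sigma>0. {} \<notin> set \<tau>" "length (flat \<sigma>0) \<le> Suc n"
     "\<Union>(underlying ` set \<sigma>0) = {1..m}" "sorted_wrt disjnt (flat \<sigma>0)"
     "\<And>d x y. d \<le> 1 \<Longrightarrow> at_dist d (flat \<sigma>0) x y \<longleftrightarrow> at_dist d L x y"
    using split_at_gaps[of L] disj U lL unfolding Union_flat by auto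
  \<comment> \<open>The parts come in the order of letters, an assembly wants increasing minima.
    Permuting whole parts changes neither the total length nor the distances inside parts.\<close>
  define \<sigma> where "\<sigma> = sort_key (Min \<circ> underlying) \<sigma>0"
  have set: "set \<sigma> = set \<sigma>0" and mset: "mset \<sigma> = mset \<sigma>0" by (simp_all add: \<sigma>_def)
  have ne: "{} \<notin> underlying ` set \<sigma>0"
    using \<sigma>0(1,2) by (auto simp: underlying_def) (metis last_in_set)
  have "sorted_wrt disjnt (map underlying \<sigma>0)"
    using \<sigma>0(5) by (simp add: sorted_wrt_disjnt_flat)
  then have "sorted_wrt disjnt (map underlying \<sigma>)"
    using ne mset_eq_imp_distinct_iff[of "map underlying \<sigma>" "map underlying \<sigma>0"]
    by (simp add: sorted_wrt_disjnt_iff set mset)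
  moreover have "sorted (map (Min \<circ> underlying) \<sigma>)" by (simp add: \<sigma>_def)
  ultimately have asm: "is_assembly m \<sigma>"
    using \<sigma>0 ne by (simp add: is_assembly_iff is_ordered_partition_iff set sorted_wrt_disjnt_flat)
  have "length (flat \<sigma>) = length (flat \<sigma>0)"
    by (simp add: length_flat mset_eq_length[OF mset] flip: sum_mset_sum_list)
      (simp add: \<sigma>_def)
  moreover have "\<sigma> \<noteq> []" using \<sigma>0(4) m set by auto
  note AOP_bound_iff[OF this, of n]
  ultimately have "\<sigma> \<in> AOP n m"
    unfolding AOP_def using asm \<sigma>0(3) by simp
  moreover have "realizes w \<sigma>"
    unfolding realizes_def lw
  proof (intro ballI)
    fix d :: int and x y assume d: "d \<in> {0, 1}" and x: "x \<in> {1..m}" and y: "y \<in> {1..m}"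
    have "(\<exists>\<tau>\<in>set \<sigma>. at_dist d \<tau> x y) \<longleftrightarrow> at_dist d (flat \<sigma>0) x y"
      using d by (subst at_dist_flat) (auto simp: set)
    also have "\<dots> \<longleftrightarrow> at_dist d L x y" using d by (intro \<sigma>0(6)) auto
    also have "\<dots> \<longleftrightarrow> \<bar>int (w ! (x - 1) - 1) - int (w ! (y - 1) - 1)\<bar> = d"
      using wx[OF x] wx[OF y] lL by (intro at_dist_disjnt[OF disj]) auto
    \<comment> \<open>Letters are positive, so both truncated subtractions are exact and
      cancel.\<close>
    also have "\<dots> \<longleftrightarrow> \<bar>int (w ! (x - 1)) - int (w ! (y - 1))\<bar> = d"
      using wx[OF x] wx[OF y] by (simp add: of_nat_diff)
    finally show "(\<exists>\<tau>\<in>set \<sigma>. at_dist d \<tau> x y) \<longleftrightarrow> \<bar>int (w ! (x - 1)) - int (w ! (y - 1))\<bar> = d" .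
  qed
  ultimately show ?thesis by blast
qed

section \<open>Recovering an assembly up to reversal of its parts\<close>

definition linked :: "ordered_partition list \<Rightarrow> (nat \<times> nat) set" where
  "linked \<sigma> = {(x, y). \<exists>d\<in>{0, 1}. \<exists>\<tau>\<in>set \<sigma>. at_dist d \<tau> x y}"

lemma part_unique:
  assumes "is_assembly m \<sigma>" "\<tau> \<in> set \<sigma>" "\<rho> \<in> set \<sigma>" "x \<in> underlying \<tau>" "x \<in> underlying \<rho>"
  shows "\<tau> = \<rho>"
proof -
  obtain a b where "a < length \<sigma>" "\<sigma> ! a = \<tau>" "b < length \<sigma>" "\<sigma> ! b = \<rho>"
    using assms by (auto simp: in_set_conv_nth)
  then show ?thesis
    using assms sorted_wrt_disjnt_index_eq[of "map underlying \<sigma>" a b x]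
    by (auto simp: is_assembly_iff)
qed

text \<open>A link never leaves a part, because parts are disjoint. Conversely all blocks of a part
  are nonempty, so stepping through consecutive blocks connects any two of its elements.\<close>

lemma linked_rtrancl_class:
  assumes asm: "is_assembly m \<sigma>" and \<tau>: "\<tau> \<in> set \<sigma>" and x: "x \<in> underlying \<tau>"
  shows "(linked \<sigma>)\<^sup>* `` {x} = underlying \<tau>"
proof
  have "y \<in> underlying \<tau>" if "(x, y) \<in> (linked \<sigma>)\<^sup>*" for y
    using that
  proof induction
    case (step y z)
    then obtain \<rho> d where "\<rho> \<in> set \<sigma>" "at_dist d \<rho> y z" by (auto simp: linked_def)
    then show ?case
      using at_dist_members[of d \<rho> y z] part_unique[OF asm \<tau>, of \<rho> y] step
      by (auto simp: underlying_def)
  qed (use x in simp)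
  then show "(linked \<sigma>)\<^sup>* `` {x} \<subseteq> underlying \<tau>" by auto
next
  have up: "p < length \<tau> \<Longrightarrow> q < length \<tau> \<Longrightarrow> u \<in> \<tau> ! p \<Longrightarrow> v \<in> \<tau> ! q \<Longrightarrow> \<bar>int p - int q\<bar> \<le> 1
     \<Longrightarrow> (u, v) \<in> linked \<sigma>" for p q u v
  proof -
    assume "p < length \<tau>" "q < length \<tau>" "u \<in> \<tau> ! p" "v \<in> \<tau> ! q" and d: "\<bar>int p - int q\<bar> \<le> 1"
    then have "at_dist \<bar>int p - int q\<bar> \<tau> u v" unfolding at_dist_def by blast
    moreover have "\<bar>int p - int q\<bar> \<in> {0, 1}" using d by auto
    ultimately show "(u, v) \<in> linked \<sigma>" unfolding linked_def using \<tau> by blast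
  qed
  have ne: "\<tau> ! p \<noteq> {}" if "p < length \<tau>" for p
    using asm \<tau> that by (metis is_assembly_iff is_ordered_partition_iff nth_mem)
  \<comment> \<open>The path between two elements runs through the first block; both directions are
    carried along so that one end can be reversed.\<close>
  have walk: "(u, v) \<in> (linked \<sigma>)\<^sup>* \<and> (v, u) \<in> (linked \<sigma>)\<^sup>*"
    if "u \<in> \<tau> ! 0" "v \<in> \<tau> ! q" "q < length \<tau>" for u v q
    using that(2,3)
  proof (induction q arbitrary: v)
    case 0
    then show ?case using up[of 0 0 u v] up[of 0 0 v u] that(1) by auto
  next
    case (Suc q)
    obtain v' where v': "v' \<in> \<tau> ! q" using ne[of q] Suc.prems by auto
    then have "(v', v) \<in> linked \<sigma>" "(v, v') \<in> linked \<sigma>"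
      using up[of q "Suc q" v' v] up[of "Suc q" q v v'] Suc.prems by auto
    with Suc.IH[OF v'] Suc.prems show ?case
      by (meson Suc_lessD converse_rtrancl_into_rtrancl rtrancl.rtrancl_into_rtrancl)
  qed
  show "underlying \<tau> \<subseteq> (linked \<sigma>)\<^sup>* `` {x}"
  proof
    fix y assume "y \<in> underlying \<tau>"
    then obtain q where q: "q < length \<tau>" "y \<in> \<tau> ! q"
      by (auto simp: underlying_def in_set_conv_nth)
    obtain p where p: "p < length \<tau>" "x \<in> \<tau> ! p"
      using x by (auto simp: underlying_def in_set_conv_nth)
    obtain u where "u \<in> \<tau> ! 0" using ne[of 0] q by fastforce
    then show "y \<in> (linked \<sigma>)\<^sup>* `` {x}"
      using walk[of u x p] walk[of u y q] p q by (auto intro: rtrancl_trans)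
  qed
qed

lemma underlying_image_classes:
  assumes "is_assembly m \<sigma>"
  shows "underlying ` set \<sigma> = (\<lambda>x. (linked \<sigma>)\<^sup>* `` {x}) ` {1..m}"
proof (intro equalityI subsetI)
  fix A assume "A \<in> underlying ` set \<sigma>"
  then obtain \<tau> where \<tau>: "\<tau> \<in> set \<sigma>" "A = underlying \<tau>" by auto
  then have "underlying \<tau> \<noteq> {}" "underlying \<tau> \<subseteq> {1..m}"
    using assms unfolding is_assembly_iff by blast+
  then obtain x where "x \<in> underlying \<tau>" "x \<in> {1..m}" by blast
  then show "A \<in> (\<lambda>x. (linked \<sigma>)\<^sup>* `` {x}) ` {1..m}"
    using linked_rtrancl_class[OF assms \<tau>(1)] \<tau>(2) by blast
next
  fix A assume "A \<in> (\<lambda>x. (linked \<sigma>)\<^sup>* `` {x}) ` {1..m}"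
  then obtain x where x: "x \<in> {1..m}" "A = (linked \<sigma>)\<^sup>* `` {x}" by auto
  then obtain \<tau> where "\<tau> \<in> set \<sigma>" "x \<in> underlying \<tau>"
    using assms unfolding is_assembly_iff by blast
  then show "A \<in> underlying ` set \<sigma>" using linked_rtrancl_class[OF assms] x by auto
qed

text \<open>The components of \<open>linked\<close> give the set of underlying sets, and their
  strictly increasing minima leave only one order in which to list them.\<close>

lemma map_underlying_eq:
  assumes \<sigma>: "is_assembly m \<sigma>" and \<sigma>': "is_assembly m \<sigma>'" and eq: "linked \<sigma> = linked \<sigma>'"
  shows "map underlying \<sigma> = map underlying \<sigma>'"
proof -
  have im: "underlying ` set \<sigma> = underlying ` set \<sigma>'"
    using underlying_image_classes \<sigma> \<sigma>' eq by simp
  have strict: "sorted_wrt (<) (map Min (map underlying \<sigma>))" if "is_assembly m \<sigma>" for \<sigma>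
    using that by (simp add: is_assembly_def sorted_wrt_iff_nth_less)
  have fin: "finite A \<and> A \<noteq> {}" if "A \<in> underlying ` set \<sigma>" for A
    using that \<sigma> unfolding is_assembly_iff by (metis Union_upper finite_atLeastAtMost finite_subset)
  have inj: "inj_on Min (set (map underlying \<sigma>) \<union> set (map underlying \<sigma>'))"
    using inj_on_Min_disjoint[OF _ fin] \<sigma> im by (simp add: is_assembly_def partition_on_def)
  have "set (map Min (map underlying \<sigma>)) = set (map Min (map underlying \<sigma>'))"
    using im by (simp only: set_map)
  then have "map Min (map underlying \<sigma>) = map Min (map underlying \<sigma>')"
    using strict[OF \<sigma>] strict[OF \<sigma>'] by (metis strict_sorted_equal)
  then show ?thesis using inj by (simp only: inj_on_map_eq_map)
qed

text \<open>An injective walk with steps of size one never turns back.\<close>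

lemma unit_step_inj_affine:
  fixes f :: "nat \<Rightarrow> int"
  assumes inj: "inj_on f {..<r}" and step: "\<And>p. Suc p < r \<Longrightarrow> \<bar>f p - f (Suc p)\<bar> = 1"
  obtains e where "e = 1 \<or> e = -1" "\<And>p. p < r \<Longrightarrow> f p = f 0 + e * int p"
proof (cases "r < 2")
  case True
  then have "p < r \<Longrightarrow> f p = f 0 + 1 * int p" for p by (cases p) auto
  then show thesis using that by blast
next
  case False
  define e where "e = f 1 - f 0"
  have e: "e = 1 \<or> e = -1" using step[of 0] False by (auto simp: e_def)
  have const: "Suc p < r \<Longrightarrow> f (Suc p) - f p = e" for p
  proof (induction p)
    case (Suc p)
    have "f (Suc (Suc p)) \<noteq> f p" using inj Suc.prems by (auto dest: inj_onD)
    then show ?case using Suc step[of "Suc p"] e by auto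
  qed (simp add: e_def)
  have "p < r \<Longrightarrow> f p = f 0 + e * int p" for p
  proof (induction p)
    case (Suc p)
    then show ?case using const[of p] by (simp add: algebra_simps)
  qed simp
  then show thesis using e that by blast
qed

text \<open>Distance 0 determines the set of blocks, so one list is a permutation \<open>f\<close>
  of the other. Distance 1 forces \<open>f\<close> to move by unit steps, and an injective walk of
  this kind through all positions is the identity or the reversal.\<close>

lemma ordered_partition_eq_or_rev:
  assumes \<tau>: "is_ordered_partition \<tau>" and \<rho>: "is_ordered_partition \<rho>"
    and eq: "\<And>d x y. d \<in> {0, 1} \<Longrightarrow> at_dist d \<tau> x y \<longleftrightarrow> at_dist d \<rho> x y"
  shows "\<rho> = \<tau> \<or> \<rho> = rev \<tau>"
proof -
  have sub: "set \<tau> \<subseteq> set \<rho>" if \<tau>: "is_ordered_partition \<tau>" and \<rho>: "is_ordered_partition \<rho>"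
    and eq: "\<And>x y. at_dist 0 \<tau> x y \<longleftrightarrow> at_dist 0 \<rho> x y" for \<tau> \<rho>
  proof
    \<comment> \<open>A block is recovered from any of its elements as a class of distance
      0.\<close>
    have block: "A = {y. at_dist 0 \<tau> x y}"
      if \<tau>: "is_ordered_partition \<tau>" and A: "A \<in> set \<tau>" and x: "x \<in> A" for \<tau> A x
    proof -
      obtain p where "p < length \<tau>" "\<tau> ! p = A" using A by (auto simp: in_set_conv_nth)
      then show ?thesis
        using \<tau> x sorted_wrt_disjnt_index_eq[of \<tau>]
        unfolding is_ordered_partition_iff at_dist_def by auto
    qed
    fix A assume A: "A \<in> set \<tau>"
    then obtain x where x: "x \<in> A" using \<tau> by (metis ex_in_conv is_ordered_partition_def)
    have "at_dist 0 \<tau> x x" using block[OF \<tau> A x] x by blast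
    then have "at_dist 0 \<rho> x x" using eq by blast
    then have "x \<in> \<Union>(set \<rho>)" by (rule at_dist_members)
    then obtain B where B: "B \<in> set \<rho>" "x \<in> B" by blast
    have "A = B" using block[OF \<tau> A x] block[OF \<rho> B] eq by simp
    then show "A \<in> set \<rho>" using B by simp
  qed
  have set: "set \<rho> = set \<tau>" using sub[OF \<tau> \<rho>] sub[OF \<rho> \<tau>] eq by blast
  have dist: "distinct \<tau>" "distinct \<rho>"
    using \<tau> \<rho> by (auto simp: is_ordered_partition_iff sorted_wrt_disjnt_iff)
  define r where "r = length \<tau>"
  have len: "length \<rho> = r" using set dist by (metis distinct_card r_def)
  have "\<exists>q<r. \<tau> ! q = \<rho> ! p" if "p < r" for p
    using that len set by (metis in_set_conv_nth r_def)
  then obtain f where f: "\<And>p. p < r \<Longrightarrow> f p < r \<and> \<tau> ! f p = \<rho> ! p" by metis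
  have inj: "inj_on (\<lambda>p. int (f p)) {..<r}"
  proof (rule inj_onI)
    fix p q assume pq: "p \<in> {..<r}" "q \<in> {..<r}" "int (f p) = int (f q)"
    then have "\<rho> ! p = \<rho> ! q" using f by (metis lessThan_iff of_nat_eq_iff)
    then show "p = q" using pq(1,2) dist(2) len by (simp add: nth_eq_iff_index_eq)
  qed
  have step: "\<bar>int (f p) - int (f (Suc p))\<bar> = 1" if p: "Suc p < r" for p
  proof -
    obtain x y where xy: "x \<in> \<rho> ! p" "y \<in> \<rho> ! Suc p"
      using p len \<rho> unfolding is_ordered_partition_def
      by (metis Suc_lessD ex_in_conv nth_mem)
    then have "at_dist 1 \<rho> x y"
      using p len unfolding at_dist_def by (intro exI[of _ p] exI[of _ "Suc p"]) auto
    then have "at_dist 1 \<tau> x y" using eq by simp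
    then show ?thesis
      using at_dist_disjnt[of \<tau> "f p" "f (Suc p)" x y 1] \<tau> f[of p] f[of "Suc p"] p xy
      by (simp add: is_ordered_partition_iff r_def)
  qed
  show ?thesis
  proof (cases "r = 0")
    case True
    then show ?thesis using len by (simp add: r_def)
  next
    case False
    obtain e where e: "e = 1 \<or> e = (-1::int)" and aff: "\<And>p. p < r \<Longrightarrow> int (f p) = int (f 0) + e * int p"
      using unit_step_inj_affine[OF inj step] by blast
    \<comment> \<open>Both ends of the walk lie below \<open>r\<close>, which fixes its start:
      \<open>f 0 = 0\<close> for \<open>e = 1\<close>, and \<open>f 0 = r - 1\<close> for
      \<open>e = -1\<close>.\<close>
    have last: "int (f (r - 1)) = int (f 0) + e * int (r - 1)" "f (r - 1) < r" "f 0 < r"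
      using aff[of "r - 1"] f[of "r - 1"] f[of 0] False by auto
    from e show ?thesis
    proof
      assume e: "e = 1"
      have "f p = p" if "p < r" for p using aff[OF that] last e by auto
      then have "\<rho> ! p = \<tau> ! p" if "p < r" for p using f that by metis
      then have "\<rho> = \<tau>" using len by (intro nth_equalityI) (simp_all add: r_def)
      then show ?thesis ..
    next
      assume e: "e = -1"
      have "f p = r - Suc p" if "p < r" for p using aff[OF that] last e that by auto
      then have "\<rho> ! p = \<tau> ! (r - Suc p)" if "p < r" for p using f that by metis
      then have "\<rho> = rev \<tau>" using len by (intro nth_equalityI) (simp_all add: r_def rev_nth)
      then show ?thesis ..
    qed
  qed
qed

text \<open>Reversal preserves distances, which gives one direction. For the other, the underlying
  sets agree index by index, and the distances inside each pair of corresponding parts decide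
  between equality and reversal.\<close>

lemma AOP_equiv_iff:
  assumes \<sigma>: "\<sigma> \<in> AOP n m" and \<sigma>': "\<sigma>' \<in> AOP n m"
  shows "(\<sigma>, \<sigma>') \<in> AOP_equiv n m \<longleftrightarrow> (\<forall>d\<in>{0, 1}. \<forall>x\<in>{1..m}. \<forall>y\<in>{1..m}.
     (\<exists>\<tau>\<in>set \<sigma>. at_dist d \<tau> x y) \<longleftrightarrow> (\<exists>\<tau>\<in>set \<sigma>'. at_dist d \<tau> x y))" (is "_ \<longleftrightarrow> ?r")
proof
  assume "(\<sigma>, \<sigma>') \<in> AOP_equiv n m"
  then have len: "length \<sigma> = length \<sigma>'" and "\<forall>a<length \<sigma>. \<sigma>' ! a = \<sigma> ! a \<or> \<sigma>' ! a = rev (\<sigma> ! a)"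
    by (auto simp: AOP_equiv_def)
  then have "at_dist d (\<sigma>' ! a) x y \<longleftrightarrow> at_dist d (\<sigma> ! a) x y" if "a < length \<sigma>" for a d x y
    using that at_dist_rev by metis
  with len show ?r by (metis in_set_conv_nth)
next
  assume r: ?r
  have asm: "is_assembly m \<sigma>" "is_assembly m \<sigma>'" using \<sigma> \<sigma>' by (auto simp: AOP_def)
  \<comment> \<open>Distances relate only elements of \<open>{1..m}\<close>, so the bounded
    hypothesis extends to all \<open>x\<close> and \<open>y\<close>.\<close>
  have mem: "x \<in> {1..m} \<and> y \<in> {1..m}"
    if "is_assembly m \<sigma>" "\<tau> \<in> set \<sigma>" "at_dist d \<tau> x y" for \<sigma> \<tau> x y d
    using that at_dist_members[OF that(3)] unfolding is_assembly_iff underlying_def by blast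
  have eq: "(\<exists>\<tau>\<in>set \<sigma>. at_dist d \<tau> x y) \<longleftrightarrow> (\<exists>\<tau>\<in>set \<sigma>'. at_dist d \<tau> x y)" if "d \<in> {0, 1}" for d x y
    using r that mem[OF asm(1)] mem[OF asm(2)] by meson
  have und: "map underlying \<sigma> = map underlying \<sigma>'"
    using asm by (rule map_underlying_eq) (use eq in \<open>auto simp: linked_def\<close>)
  then have len: "length \<sigma> = length \<sigma>'" by (metis length_map)
  have "\<sigma>' ! a = \<sigma> ! a \<or> \<sigma>' ! a = rev (\<sigma> ! a)" if a: "a < length \<sigma>" for a
  proof (rule ordered_partition_eq_or_rev)
    have in_set: "\<sigma> ! a \<in> set \<sigma>" "\<sigma>' ! a \<in> set \<sigma>'" using a len by auto
    then show "is_ordered_partition (\<sigma> ! a)" "is_ordered_partition (\<sigma>' ! a)"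
      using asm by (auto simp: is_assembly_def)
    have u: "underlying (\<sigma> ! a) = underlying (\<sigma>' ! a)"
      using und a len by (metis nth_map)
    \<comment> \<open>Within one part the relation is the global one restricted to that part, so
      global agreement can be localised.\<close>
    have loc: "at_dist d \<tau> x y \<longleftrightarrow> x \<in> underlying \<tau> \<and> (\<exists>\<tau>\<in>set \<sigma>. at_dist d \<tau> x y)"
      if "is_assembly m \<sigma>" "\<tau> \<in> set \<sigma>" for \<sigma> \<tau> d x y
      using that part_unique[OF that] at_dist_members(1)[of d _ x y]
      unfolding underlying_def by metis
    show "at_dist d (\<sigma> ! a) x y \<longleftrightarrow> at_dist d (\<sigma>' ! a) x y" if "d \<in> {0, 1}" for d x y
      using loc[OF asm(1) in_set(1)] loc[OF asm(2) in_set(2)] eq[OF that] u by metis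
  qed
  then show "(\<sigma>, \<sigma>') \<in> AOP_equiv n m"
    using \<sigma> \<sigma>' len by (simp add: AOP_equiv_def)
qed

section \<open>From matrices to the bijection\<close>

text \<open>Below the diagonal the three distinct values -2, 1 and 0 encode distance 0, distance 1
  and anything larger. Symmetry of the distance covers the other pairs.\<close>

lemma bs_matrix_eq_iff:
  assumes "length w = m" "length w' = m"
  shows "bs_matrix w = bs_matrix w' \<longleftrightarrow> (\<forall>d\<in>{0, 1}. \<forall>x\<in>{1..m}. \<forall>y\<in>{1..m}.
     \<bar>int (w ! (x - 1)) - int (w ! (y - 1))\<bar> = d \<longleftrightarrow> \<bar>int (w' ! (x - 1)) - int (w' ! (y - 1))\<bar> = d)"
    (is "_ \<longleftrightarrow> ?r")
proof
  assume eq: "bs_matrix w = bs_matrix w'"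
  have lt: "\<bar>int (w ! j) - int (w ! k)\<bar> = d \<longleftrightarrow> \<bar>int (w' ! j) - int (w' ! k)\<bar> = d"
    if "d \<in> {0, 1}" "k < j" "j < m" for d j k
    using arg_cong[OF eq, of "\<lambda>B. B $$ (j, k)"] that assms
    by (auto simp: bs_matrix_def split: if_splits)
  have "\<bar>int (w ! j) - int (w ! k)\<bar> = d \<longleftrightarrow> \<bar>int (w' ! j) - int (w' ! k)\<bar> = d"
    if "d \<in> {0, 1}" "k < m" "j < m" for d j k
    using lt[of d j k] lt[of d k j] that by (cases j k rule: linorder_cases) (auto simp: abs_minus_commute)
  then show ?r by (intro ballI) (simp only: atLeastAtMost_iff, metis One_nat_def Suc_diff_1 Suc_le_eq)
next
  assume r: ?r
  have "\<bar>int (w ! j) - int (w ! k)\<bar> = d \<longleftrightarrow> \<bar>int (w' ! j) - int (w' ! k)\<bar> = d"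
    if "d \<in> {0, 1}" "k < m" "j < m" for d j k
    using r[rule_format, of d "Suc j" "Suc k"] that by simp
  from this[of 0] this[of 1] show "bs_matrix w = bs_matrix w'"
    using assms by (intro eq_matI) (auto simp: bs_matrix_def)
qed

text \<open>Choose a preimage under \<open>F\<close>, then a \<open>Q\<close>-related element, and
  take its class. In \<open>eq\<close>, the direction from left to right makes the class independent
  of the choices, which gives surjectivity; the converse gives injectivity.\<close>

lemma bij_betw_image_quotient:
  assumes E: "equiv A E"
    and total: "\<And>x. x \<in> X \<Longrightarrow> \<exists>a\<in>A. Q x a" and onto: "\<And>a. a \<in> A \<Longrightarrow> \<exists>x\<in>X. Q x a"
    and eq: "\<And>x y a b. \<lbrakk>x \<in> X; y \<in> X; a \<in> A; b \<in> A; Q x a; Q y b\<rbrakk> \<Longrightarrow> F x = F y \<longleftrightarrow> (a, b) \<in> E"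
  shows "\<exists>f. bij_betw f (F ` X) (A // E)"
proof -
  obtain g where g: "\<And>x. x \<in> X \<Longrightarrow> g x \<in> A \<and> Q x (g x)" using total by metis
  define h where "h t = inv_into X F t" for t
  have h: "h t \<in> X" "F (h t) = t" if "t \<in> F ` X" for t
    using that by (auto simp: h_def inv_into_into f_inv_into_f)
  have "inj_on (\<lambda>t. E `` {g (h t)}) (F ` X)"
  proof (rule inj_onI)
    fix s t assume st: "s \<in> F ` X" "t \<in> F ` X" and "E `` {g (h s)} = E `` {g (h t)}"
    then have "(g (h s), g (h t)) \<in> E" using eq_equiv_class[OF _ E] g h by blast
    then show "s = t" using eq[of "h s" "h t"] g h st by metis
  qed
  moreover have "(\<lambda>t. E `` {g (h t)}) ` (F ` X) = A // E"
  proof (intro equalityI subsetI)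
    fix c assume "c \<in> (\<lambda>t. E `` {g (h t)}) ` (F ` X)"
    then show "c \<in> A // E" using g h(1) by (auto intro!: quotientI)
  next
    fix c assume "c \<in> A // E"
    then obtain a where a: "a \<in> A" "c = E `` {a}" by (auto elim: quotientE)
    then obtain x where x: "x \<in> X" "Q x a" using onto by blast
    have Fx: "F x \<in> F ` X" using x by blast
    have "(a, g (h (F x))) \<in> E"
      using eq[of x "h (F x)" a "g (h (F x))"] x a h[OF Fx] g[of "h (F x)"] by simp
    then have "c = E `` {g (h (F x))}" using equiv_class_eq[OF E] a(2) by simp
    then show "c \<in> (\<lambda>t. E `` {g (h t)}) ` (F ` X)" using x by blast
  qed
  ultimately show ?thesis unfolding bij_betw_def by blast
qed

theorem theorem1p1:
  fixes n m :: nat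
  assumes "n > 0" and "m > 0"
  shows "\<exists>f. bij_betw f {bs_manifold is | is. is \<in> words n m} (AOP n m // AOP_equiv n m)"
proof -
  have "bs_manifold w = bs_manifold w' \<longleftrightarrow> (\<sigma>, \<sigma>') \<in> AOP_equiv n m"
    if "w \<in> words n m" "w' \<in> words n m" "\<sigma> \<in> AOP n m" "\<sigma>' \<in> AOP n m" "realizes w \<sigma>" "realizes w' \<sigma>'"
    for w w' \<sigma> \<sigma>'
  proof -
    have len: "length w = m" "length w' = m" using that by (auto simp: words_def)
    have "bs_manifold w = bs_manifold w' \<longleftrightarrow> bs_matrix w = bs_matrix w'"
      unfolding bs_manifold_def using bott_matrix_bs_matrix len by (metis bott_manifold_eq_iff)
    also have "\<dots> \<longleftrightarrow> (\<sigma>, \<sigma>') \<in> AOP_equiv n m"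
    proof -
      \<comment> \<open>Realization turns letter distances into block distances, so the criterion
        for equal matrices becomes the criterion for equivalent assemblies.\<close>
      have r: "(\<exists>\<tau>\<in>set \<sigma>. at_dist d \<tau> x y) \<longleftrightarrow> \<bar>int (w ! (x - 1)) - int (w ! (y - 1))\<bar> = d"
        "(\<exists>\<tau>\<in>set \<sigma>'. at_dist d \<tau> x y) \<longleftrightarrow> \<bar>int (w' ! (x - 1)) - int (w' ! (y - 1))\<bar> = d"
        if "d \<in> {0, 1}" "x \<in> {1..m}" "y \<in> {1..m}" for d x y
        using \<open>realizes w \<sigma>\<close> \<open>realizes w' \<sigma>'\<close> that unfolding realizes_def len by blast+
      show ?thesis
        unfolding bs_matrix_eq_iff[OF len] AOP_equiv_iff[OF that(3,4)]
        by (intro ball_cong refl) (simp only: r)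
    qed
    finally show ?thesis .
  qed
  then have "\<exists>f. bij_betw f (bs_manifold ` words n m) (AOP n m // AOP_equiv n m)"
    using word_realizes AOP_realized assms(2)
    by (intro bij_betw_image_quotient[OF equiv_AOP_equiv, where Q = realizes]) auto
  then show ?thesis by (simp only: image_def) (simp add: Bex_def conj_commute)
qed

end
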